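(* For every positive integer $N$, $$\sum_{n=1}^N H_n=(N+1)(H_{N+1}-1),\qquad \sum_{n=1}^N H_n^2=(N+1)H_{N+1}^2-(2N+3)H_{N+1}+2N+2 .$$ Moreover, for every integer $M\ge3$, as $N\to\infty$, $$\begin{aligned}\sum_{n=1}^N H_n^M={}&(N+1)H_{N+1}^M+(-1)^M M!\Bigg\{\sum_{m=3}^{M-1}\frac{(-1)^m}{m!}H_{N+1}^m\left(N+\tfrac32\right)+N+1+\left(\tfrac N2+\tfrac34\right)H_{N+1}^2-\left(N+\tfrac32\right)H_{N+1}\\&-\sum_{m=3}^M\frac{\zeta(m-1)}{m!}\left(\frac m2-1\right)+\sum_{m=4}^M\frac1{m!}\sum_{k=1}^{m-3}\left[\binom{m-1}{k}\frac m2-\binom mk\right](-1)^{k+1}\mathcal{H}^k(m-k-1)\Bigg\}+o(1).\end{aligned}$$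
   Context: $H_n=1+\frac12+\cdots+\frac1n$; $\zeta$ is the Riemann zeta function; for integers $k\ge1$, $\mathcal{H}^k(s)=\sum_{n\ge1}H_n^k n^{-s}$ (convergent for $\Re(s)>1$; here evaluated at integers $\ge2$). Empty sums are $0$. $o(1)$ denotes a quantity tending to $0$ as $N\to\infty$. *)

theory Defs
  imports "HOL-Analysis.Analysis"
begin

text \<open>
  Both functions are given by their Dirichlet series, indexed from \<open>n = 0\<close> with \<open>Suc n\<close> as the
  summation variable. They carry the intended meaning only for \<open>Re s > 1\<close>, where the series
  converge; no analytic continuation is involved. The definitions are polymorphic so that they can
  be read both for complex \<open>s\<close> and for real \<open>s\<close>.
\<close>

definition riemann_zeta :: "'a \<Rightarrow> 'a :: {real_normed_field, banach, ln}" where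
  "riemann_zeta s = (\<Sum>n. of_nat (Suc n) powr (- s))"

definition harmonic_zeta :: "nat \<Rightarrow> 'a \<Rightarrow> 'a :: {real_normed_field, banach, ln}" where
  "harmonic_zeta k s = (\<Sum>n. harm (Suc n) ^ k * of_nat (Suc n) powr (- s))"

end

theory Submission
  imports Defs
begin

text \<open>
  Abel summation turns \<open>\<Sum> H\<^sub>n\<^sup>m\<close> into \<open>\<Sum> n (H\<^sub>n\<^sup>m - H\<^sub>n\<^sub>-\<^sub>1\<^sup>m)\<close>. Expanding \<open>H\<^sub>n\<^sub>-\<^sub>1 = H\<^sub>n - 1/n\<close> by the
  binomial theorem, the terms that do not converge absolutely are \<open>m H\<^sub>n\<^sup>m\<^sup>-\<^sup>1\<close>, which gives a recursion
  in \<open>m\<close>, and a multiple of \<open>H\<^sub>n\<^sup>m\<^sup>-\<^sup>2/n\<close>, which telescopes up to further convergent terms. The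
  recursion is exact when \<open>\<H>\<^sup>k(s)\<close> is replaced by its partial sums; multiplying it by \<open>(-1)\<^sup>m/m!\<close>
  and summing over \<open>m\<close> gives an exact closed form, in which one lets \<open>N\<close> tend to infinity.
\<close>

definition harmonic_zeta_partial :: "nat \<Rightarrow> nat \<Rightarrow> nat \<Rightarrow> real" where
  "harmonic_zeta_partial k s K = (\<Sum>n<K. harm (Suc n) ^ k / real (Suc n) ^ s)"

text \<open>The coefficient of \<open>x ^ k * (-u) ^ (m - k)\<close> that remains when
  \<open>u * (m / 2) * (x - u) ^ (m - 1)\<close> is subtracted from
  \<open>x ^ m - (x - u) ^ m\<close>. It vanishes at \<open>k = m - 2\<close> for
  \<open>m \<ge> 2\<close>.\<close>

definition harmonic_coeff :: "nat \<Rightarrow> nat \<Rightarrow> real" where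
  "harmonic_coeff m k = real ((m - 1) choose k) * (real m / 2) - real (m choose k)"

text \<open>Stopping at \<open>k < m - 2\<close> keeps every exponent \<open>m - 1 - k\<close> at
  least 2, so each partial sum converges as \<open>K\<close> grows.\<close>

definition harmonic_correction :: "nat \<Rightarrow> nat \<Rightarrow> real" where
  "harmonic_correction m K =
     (\<Sum>k<m-2. harmonic_coeff m k * (-1) ^ (k + 1) * harmonic_zeta_partial k (m - 1 - k) K)"

definition harmonic_correction_limit :: "nat \<Rightarrow> real" where
  "harmonic_correction_limit m =
     (\<Sum>k<m-2. harmonic_coeff m k * (-1) ^ (k + 1) * harmonic_zeta k (real (m - 1 - k)))"

section \<open>Convergence of the series and of the correction terms\<close>

lemma harm_power_bound:
  assumes "n \<ge> 1"
  shows "(harm n :: real) ^ k \<le> (1 + 2 * real k) ^ k * real n powr (1/2)"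
proof (cases "k = 0")
  case True
  then show ?thesis using assms by (simp add: ge_one_powr_ge_zero)
next
  case False
  \<comment> \<open>Bounding the logarithm by \<open>n powr a / a\<close> costs the factor
    \<open>1 / a + 1 = 1 + 2 * k\<close>; this \<open>a\<close> makes the \<open>k\<close>-th power
    of \<open>n powr a\<close> equal to the square root of \<open>n\<close>.\<close>
  define a where "a = 1 / (2 * real k)"
  have a: "a > 0" using False by (simp add: a_def)
  have p1: "1 \<le> real n powr a" using assms a by (simp add: ge_one_powr_ge_zero)
  have "harm n \<le> ln (real n) + 1" using euler_mascheroni_sequence_decreasing[of 1 n] assms by (simp add: harm_expand)
  also have "\<dots> \<le> real n powr a / a + real n powr a"
    using ln_powr_bound[of "real n" a] assms a p1 by simp
  also have "\<dots> = (1 + 2 * real k) * real n powr a" by (simp add: a_def algebra_simps)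
  finally have "harm n \<le> (1 + 2 * real k) * real n powr a" .
  then have "harm n ^ k \<le> ((1 + 2 * real k) * real n powr a) ^ k"
    by (intro power_mono harm_nonneg)
  also have "\<dots> = (1 + 2 * real k) ^ k * real n powr (a * real k)"
    using assms by (simp add: power_mult_distrib powr_powr flip: powr_realpow)
  also have "a * real k = 1/2" using False by (simp add: a_def)
  finally show ?thesis .
qed

lemma summable_harm_power_div:
  assumes "s \<ge> 2"
  shows "summable (\<lambda>n. (harm (Suc n) :: real) ^ k / real (Suc n) ^ s)"
proof (rule summable_comparison_test)
  have "norm (harm (Suc n) ^ k / real (Suc n) ^ s) \<le>
          (1 + 2 * real k) ^ k * real (Suc n) powr (-(3/2))" for n
  proof -
    \<comment> \<open>The worst case is \<open>s = 2\<close>: the square root from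
      \<open>harm_power_bound\<close> divided by a square leaves the summable exponent -3/2.\<close>
    have "real (Suc n) ^ 2 \<le> real (Suc n) ^ s" using assms by (intro power_increasing) auto
    then have "harm (Suc n) ^ k / real (Suc n) ^ s \<le>
               ((1 + 2 * real k) ^ k * real (Suc n) powr (1/2)) / real (Suc n) ^ 2"
      by (intro frac_le harm_power_bound) auto
    also have "\<dots> = (1 + 2 * real k) ^ k * (real (Suc n) powr (1/2) / real (Suc n) powr 2)"
      by (simp add: powr_numeral del: of_nat_Suc)
    also have "\<dots> = (1 + 2 * real k) ^ k * real (Suc n) powr (-(3/2))"
      by (simp only: powr_diff[symmetric]) simp
    finally show ?thesis by (simp add: harm_nonneg abs_of_nonneg)
  qed
  then show "\<exists>N. \<forall>n\<ge>N. norm ((harm (Suc n) :: real) ^ k / real (Suc n) ^ s) \<le>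
          (1 + 2 * real k) ^ k * real (Suc n) powr (-(3/2))" by blast
  have "summable (\<lambda>n. real n powr (-(3/2)))" by (subst summable_real_powr_iff) simp
  then show "summable (\<lambda>n. (1 + 2 * real k) ^ k * real (Suc n) powr (-(3/2)))"
    by (intro summable_mult) (subst summable_Suc_iff)
qed

lemma harmonic_zeta_partial_LIMSEQ:
  assumes "s \<ge> 2"
  shows "harmonic_zeta_partial k s \<longlonglongrightarrow> harmonic_zeta k (real s)"
proof -
  have "harmonic_zeta k (real s) = (\<Sum>n. harm (Suc n) ^ k / real (Suc n) ^ s)"
    unfolding harmonic_zeta_def
    by (simp only: powr_minus of_nat_Suc divide_inverse)
       (simp add: powr_realpow add_pos_nonneg del: of_nat_Suc)
  then show ?thesis
    using summable_LIMSEQ[OF summable_harm_power_div[OF assms, of k]]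
    by (simp add: harmonic_zeta_partial_def[abs_def])
qed

lemma harmonic_correction_LIMSEQ:
  "harmonic_correction m \<longlonglongrightarrow> harmonic_correction_limit m"
  unfolding harmonic_correction_def[abs_def] harmonic_correction_limit_def
  by (intro tendsto_sum tendsto_mult tendsto_const harmonic_zeta_partial_LIMSEQ) auto

text \<open>The term \<open>k = 0\<close> is split off: there the series is the zeta function, the
  coefficient is \<open>m / 2 - 1\<close> and the sign is negative.\<close>

lemma harmonic_correction_limit_altdef:
  assumes "m \<ge> 3"
  shows "harmonic_correction_limit m =
     (\<Sum>k=1..m-3. harmonic_coeff m k * (-1) ^ (k + 1) * harmonic_zeta k (real m - real k - 1))
     - riemann_zeta (real m - 1) * (real m / 2 - 1)"
proof -
  let ?f = "\<lambda>k. harmonic_coeff m k * (-1) ^ (k + 1) * harmonic_zeta k (real (m - 1 - k))"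
  have "{..<m-2} = insert 0 {1..m-3}" using assms by auto
  then have "harmonic_correction_limit m = ?f 0 + (\<Sum>k=1..m-3. ?f k)"
    by (simp add: harmonic_correction_limit_def)
  moreover have "(\<Sum>k=1..m-3. ?f k) =
     (\<Sum>k=1..m-3. harmonic_coeff m k * (-1) ^ (k + 1) * harmonic_zeta k (real m - real k - 1))"
    using assms by (intro sum.cong refl) (auto simp: of_nat_diff algebra_simps)
  moreover have "?f 0 = - (riemann_zeta (real m - 1) * (real m / 2 - 1))"
    using assms
    by (simp add: harmonic_coeff_def harmonic_zeta_def riemann_zeta_def of_nat_diff algebra_simps)
  ultimately show ?thesis by simp
qed

section \<open>Exact recursion and closed form\<close>

text \<open>
  The second term on the right is chosen to cancel the term of degree 2 in \<open>u\<close>.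
\<close>

lemma power_diff_trapezoid_expansion:
  fixes x u :: real
  assumes "m \<ge> 2"
  shows "x ^ m - (x - u) ^ m =
     u * (real m / 2) * x ^ (m - 1) + u * (real m / 2) * (x - u) ^ (m - 1)
     + (\<Sum>k<m-2. harmonic_coeff m k * x ^ k * (-u) ^ (m - k))"
proof -
  obtain p where m: "m = Suc (Suc p)" using assms by (metis add_2_eq_Suc le_Suc_ex)
  let ?g = "\<lambda>k. harmonic_coeff m k * x ^ k * (-u) ^ (m - k)"
  have 1: "(x - u) ^ m = x ^ m + (\<Sum>k\<le>Suc p. real (m choose k) * x ^ k * (-u) ^ (m - k))"
    using binomial_ring[of x "-u" m] by (simp add: m)
  have "(x - u) ^ (m - 1) = (\<Sum>k\<le>Suc p. real ((m - 1) choose k) * x ^ k * (-u) ^ (m - 1 - k))"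
    using binomial_ring[of x "-u" "m - 1"] by (simp only: m) simp
  then have "- u * (real m / 2) * (x - u) ^ (m - 1) =
     (\<Sum>k\<le>Suc p. real ((m - 1) choose k) * (real m / 2) * x ^ k * (-u) ^ (m - k))"
    by (simp only: sum_distrib_left) (intro sum.cong refl, auto simp: m Suc_diff_le)
  with 1 have "x ^ m - (x - u) ^ m - u * (real m / 2) * (x - u) ^ (m - 1) = (\<Sum>k\<le>Suc p. ?g k)"
    by (simp add: harmonic_coeff_def algebra_simps sum_subtractf)
  also have "\<dots> = (\<Sum>k<p. ?g k) + ?g p + ?g (Suc p)"
    by (simp add: atMost_Suc lessThan_Suc_atMost[symmetric])
  \<comment> \<open>This is the cancellation in degree 2: with \<open>m = p + 2\<close>, both (m-1
    choose m-2) * m/2 and (m choose m-2) equal m(m-1)/2.\<close>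
  also have "?g p = 0"
  proof -
    have "real (Suc (Suc p) choose p) = real (Suc (Suc p)) * real (Suc p) / 2"
    proof -
      have "Suc (Suc p) choose p = Suc (Suc p) choose 2"
        using binomial_symmetric[of p "Suc (Suc p)"] by (simp del: binomial_Suc_Suc)
      moreover have "2 * (Suc (Suc p) choose 2) = Suc (Suc p) * Suc p"
        using Suc_times_binomial[of 1 "Suc p"] by (simp add: numeral_2_eq_2 del: binomial_Suc_Suc)
      then have "2 * real (Suc (Suc p) choose 2) = real (Suc (Suc p)) * real (Suc p)"
        by (metis of_nat_mult of_nat_numeral)
      ultimately show ?thesis by (simp del: binomial_Suc_Suc)
    qed
    then show ?thesis by (simp add: harmonic_coeff_def m binomial_Suc_n)
  qed
  also have "?g (Suc p) = u * (real m / 2) * x ^ (m - 1)"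
    by (simp add: harmonic_coeff_def m binomial_Suc_n field_simps)
  finally show ?thesis by (simp add: m algebra_simps)
qed

text \<open>Abel summation in the form of an induction on \<open>K\<close>. The increment of the
  claim is the trapezoid expansion with \<open>u = 1 / Suc K\<close>, multiplied by
  \<open>Suc K\<close>. The mean of consecutive powers of degree \<open>m - 1\<close> yields both
  the sum of lower degree and the boundary term with factor \<open>m / 2\<close>.\<close>

lemma sum_harm_power_rec:
  assumes "m \<ge> 2"
  shows "(\<Sum>n<K. (harm n :: real) ^ m) =
     real K * harm K ^ m - real m / 2 * harm K ^ (m - 1) - real m * (\<Sum>n<K. harm n ^ (m - 1))
     + (-1) ^ m * harmonic_correction m K"
proof (induction K)
  case 0
  then show ?case using assms
    by (simp add: harm_def harmonic_correction_def harmonic_zeta_partial_def)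
next
  case (Suc K)
  define q x where "q = real (Suc K)" and "x = (harm (Suc K) :: real)"
  have q: "q > 0" by (simp add: q_def)
  have h: "harm K = x - 1 / q" by (simp add: x_def q_def harm_Suc divide_inverse)
  \<comment> \<open>The factor \<open>q\<close> lowers the exponent of \<open>1 / q\<close> from
    \<open>m - k\<close> to \<open>m - 1 - k\<close>, and (-1)^(m-k) = -(-1)^m (-1)^(k+1).\<close>
  have summand: "q * (harmonic_coeff m k * x ^ k * (- (1 / q)) ^ (m - k)) =
      - ((-1) ^ m) * (harmonic_coeff m k * (-1) ^ (k + 1) * (x ^ k / q ^ (m - 1 - k)))"
    if "k < m - 2" for k
  proof -
    obtain j where j: "m = Suc (k + j)" using \<open>k < m - 2\<close> by (metis less_diff_conv add_lessD1 less_iff_Suc_add)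
    show ?thesis using q by (simp add: j power_add power_minus[of "1/q"] power_one_over field_simps)
  qed
  have "harmonic_correction m (Suc K) - harmonic_correction m K =
     (\<Sum>k<m-2. harmonic_coeff m k * (-1) ^ (k + 1) * (x ^ k / q ^ (m - 1 - k)))"
    by (simp add: harmonic_correction_def harmonic_zeta_partial_def x_def q_def
        algebra_simps flip: sum_subtractf)
  then have "q * (\<Sum>k<m-2. harmonic_coeff m k * x ^ k * (- (1 / q)) ^ (m - k)) =
     - ((-1) ^ m) * (harmonic_correction m (Suc K) - harmonic_correction m K)"
    by (simp only: sum_distrib_left) (intro sum.cong refl, use summand in auto)
  moreover have "q * (x ^ m - harm K ^ m) = 
     real m / 2 * x ^ (m - 1) + real m / 2 * harm K ^ (m - 1)
     + q * (\<Sum>k<m-2. harmonic_coeff m k * x ^ k * (- (1 / q)) ^ (m - k))"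
    unfolding h power_diff_trapezoid_expansion[OF assms, of x "1 / q"]
    using q by (simp add: distrib_left)
  ultimately have step: "q * (x ^ m - harm K ^ m) = 
     real m / 2 * x ^ (m - 1) + real m / 2 * harm K ^ (m - 1)
     - (-1) ^ m * (harmonic_correction m (Suc K) - harmonic_correction m K)" by simp
  have qK: "real K = q - 1" by (simp add: q_def)
  show ?case using step Suc.IH
    unfolding qK sum.lessThan_Suc q_def[symmetric] x_def[symmetric]
    by (simp add: algebra_simps)
qed

text \<open>The starting value for the recursion, which begins at \<open>m = 2\<close>. At
  \<open>m = 2\<close> the correction is an empty sum.\<close>

lemma sum_harm: "(\<Sum>n<K. harm n :: real) = real K * (harm K - 1)"
proof (induction K)
  case (Suc K)
  have "real (Suc K) * harm (Suc K) = real (Suc K) * harm K + 1"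
    by (simp add: harm_Suc distrib_left del: of_nat_Suc)
  with Suc.IH show ?case by (simp add: algebra_simps)
qed simp

lemma sum_harm_square:
  "(\<Sum>n<K. (harm n :: real) ^ 2) = real K * harm K ^ 2 - (2 * real K + 1) * harm K + 2 * real K"
  using sum_harm_power_rec[of 2 K]
  by (simp add: sum_harm harmonic_correction_def algebra_simps)

text \<open>After multiplication by (-1)^m/m! the factor \<open>- m\<close> in
  \<open>sum_harm_power_rec\<close> becomes 1, so the recursion telescopes in \<open>m\<close>. Each
  power of \<open>harm K\<close> below the top one receives \<open>K\<close> from its own step and
  1/2 from the boundary term of the next; the top power receives only \<open>K\<close>. The terms of
  degree at most 2 come from \<open>sum_harm_square\<close>, with 1/4 added by the step to degree
  3.\<close>

lemma sum_harm_power_closed_form: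
  assumes "M \<ge> 3"
  shows "(\<Sum>n<K. (harm n :: real) ^ M) = real K * harm K ^ M + (-1) ^ M * fact M *
     ((\<Sum>m=3..M-1. (-1) ^ m / fact m * harm K ^ m * (real K + 1 / 2))
      + real K + (real K / 2 + 1 / 4) * harm K ^ 2 - (real K + 1 / 2) * harm K
      + (\<Sum>m=3..M. harmonic_correction m K / fact m))"
  using assms
proof (induction M rule: dec_induct)
  case base
  show ?case using sum_harm_power_rec[of 3 K]
    by (simp add: sum_harm_square fact_numeral algebra_simps)
next
  case (step M)
  let ?A = "\<Sum>m=3..M-1. (-1) ^ m / fact m * harm K ^ m * (real K + 1 / 2)"
  let ?B = "real K + (real K / 2 + 1 / 4) * harm K ^ 2 - (real K + 1 / 2) * harm K"
  let ?C = "\<Sum>m=3..M. harmonic_correction m K / fact m"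
  have A: "(\<Sum>m=3..Suc M-1. (-1) ^ m / fact m * harm K ^ m * (real K + 1 / 2)) =
     ?A + (-1) ^ M / fact M * harm K ^ M * (real K + 1 / 2)"
    using step.hyps by (cases M) auto
  have C: "(\<Sum>m=3..Suc M. harmonic_correction m K / fact m) =
     ?C + harmonic_correction (Suc M) K / fact (Suc M)"
    using step.hyps by simp
  have sgn: "((-1) ^ M * (-1) ^ M :: real) = 1" by (simp flip: power_mult_distrib)
  have f: "(fact (Suc M) :: real) = real (Suc M) * fact M" by simp
  have nz: "(fact M :: real) \<noteq> 0" "real (Suc M) \<noteq> 0" by simp_all
  have e1: "(-1) ^ Suc M * fact (Suc M) * ((-1) ^ M / fact M * harm K ^ M * (real K + 1 / 2))
     = - real (Suc M) * harm K ^ M * (real K + 1/2) * ((-1) ^ M * (-1) ^ M)"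
    unfolding f using nz by (simp add: field_simps del: of_nat_Suc)
  have e2: "(-1) ^ Suc M * fact (Suc M) * (harmonic_correction (Suc M) K / fact (Suc M)) =
     (-1) ^ Suc M * harmonic_correction (Suc M) K"
    by (simp del: fact_Suc)
  have "(\<Sum>n<K. (harm n :: real) ^ Suc M) = real K * harm K ^ Suc M
     - real (Suc M) / 2 * harm K ^ M - real (Suc M) * (\<Sum>n<K. harm n ^ M)
     + (-1) ^ Suc M * harmonic_correction (Suc M) K"
    using sum_harm_power_rec[of "Suc M" K] step.hyps by simp
  also have "\<dots> = real K * harm K ^ Suc M + (-1) ^ Suc M * fact (Suc M) * (?A + ?B + ?C)
     + (-1) ^ Suc M * fact (Suc M) * ((-1) ^ M / fact M * harm K ^ M * (real K + 1 / 2))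
     + (-1) ^ Suc M * fact (Suc M) * (harmonic_correction (Suc M) K / fact (Suc M))"
  proof -
    have IH: "(\<Sum>n<K. harm n ^ M) = real K * harm K ^ M + (-1) ^ M * fact M * (?A + ?B + ?C)"
      unfolding step.IH by (simp only: add_ac add_diff_eq diff_add_eq)
    \<comment> \<open>The new summand with \<open>k + 1 / 2\<close> joins the boundary term
      \<open>R / 2 * H\<close> to the leading term \<open>R * k * H\<close> of the induction
      hypothesis; the factor 1 stands for the squared sign.\<close>
    have rearrange: "X - R / 2 * H - R * (k * H + s * F * Y) + Z =
        X + - s * (R * F) * Y + - R * H * (k + 1 / 2) * 1 + Z" for X R H k s F Y Z :: real
      by (simp add: field_simps)
    show ?thesis unfolding e1 e2 sgn IH unfolding f power_Suc[of "-1"] mult_minus1 by (rule rearrange)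
  qed
  also have "\<dots> = real K * harm K ^ Suc M + (-1) ^ Suc M * fact (Suc M) *
     ((?A + (-1) ^ M / fact M * harm K ^ M * (real K + 1 / 2)) + ?B
      + (?C + harmonic_correction (Suc M) K / fact (Suc M)))"
    by (simp only: distrib_left add_ac)
  finally show ?case unfolding A C by (simp only: add_ac add_diff_eq)
qed

section \<open>Shift to sums from 1 to N and passage to the limit\<close>

lemma sum_harm_power_shift:
  assumes "m \<ge> 1"
  shows "(\<Sum>n=1..N. (harm n :: real) ^ m) = (\<Sum>n<N+1. harm n ^ m)"
proof -
  \<comment> \<open>The extra term vanishes because \<open>harm 0 = 0\<close> and the exponent is
    positive. Taking \<open>K = N + 1\<close> is what brings \<open>harm (N + 1)\<close> into the
    final formulas.\<close>
  have "{..<N+1} = insert 0 {1..N}" by auto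
  then show ?thesis using assms by (simp add: harm_expand)
qed

theorem theorem13:
  shows "(\<forall>N::nat. N \<ge> 1 \<longrightarrow>
            (\<Sum>n=1..N. harm n :: real) = (real N + 1) * (harm (N + 1) - 1) \<and>
            (\<Sum>n=1..N. (harm n :: real) ^ 2) =
              (real N + 1) * harm (N + 1) ^ 2 - (2 * real N + 3) * harm (N + 1) + 2 * real N + 2) \<and>
         (\<forall>M::nat. M \<ge> 3 \<longrightarrow>
            (\<lambda>N::nat. (\<Sum>n=1..N. (harm n :: real) ^ M) -
               ((real N + 1) * harm (N + 1) ^ M +
                (-1) ^ M * fact M *
                  ((\<Sum>m=3..M-1. (-1) ^ m / fact m * harm (N + 1) ^ m * (real N + 3 / 2))
                   + real N + 1
                   + (real N / 2 + 3 / 4) * harm (N + 1) ^ 2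
                   - (real N + 3 / 2) * harm (N + 1)
                   - (\<Sum>m=3..M. riemann_zeta (real m - 1) / fact m * (real m / 2 - 1))
                   + (\<Sum>m=4..M. 1 / fact m *
                        (\<Sum>k=1..m-3. (real ((m - 1) choose k) * (real m / 2) - real (m choose k)) *
                           (-1) ^ (k + 1) * harmonic_zeta k (real m - real k - 1))))))
            \<longlonglongrightarrow> 0)"
proof (intro conjI allI impI)
  fix N :: nat
  show "(\<Sum>n=1..N. harm n :: real) = (real N + 1) * (harm (N + 1) - 1)"
    using sum_harm_power_shift[of 1 N] sum_harm[of "N + 1"] by (simp add: add_ac)
  show "(\<Sum>n=1..N. (harm n :: real) ^ 2) =
          (real N + 1) * harm (N + 1) ^ 2 - (2 * real N + 3) * harm (N + 1) + 2 * real N + 2"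
    using sum_harm_power_shift[of 2 N] sum_harm_square[of "N + 1"] by (simp add: algebra_simps)
next
  fix M :: nat
  assume M: "M \<ge> 3"
  let ?Z = "\<Sum>m=3..M. riemann_zeta (real m - 1) / fact m * (real m / 2 - 1)"
  let ?H = "\<Sum>m=4..M. 1 / fact m *
              (\<Sum>k=1..m-3. (real ((m - 1) choose k) * (real m / 2) - real (m choose k)) *
                 (-1) ^ (k + 1) * harmonic_zeta k (real m - real k - 1))"
  let ?L = "\<Sum>m=3..M. harmonic_correction_limit m / fact m"
  \<comment> \<open>At \<open>m = 3\<close> the inner range \<open>1..m-3\<close> is empty, so the
    outer sum may start at 3 like the zeta sum.\<close>
  have "{3..M} = insert 3 {4..M}" using M by auto
  then have "?H = (\<Sum>m=3..M. 1 / fact m *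
              (\<Sum>k=1..m-3. harmonic_coeff m k *
                 (-1) ^ (k + 1) * harmonic_zeta k (real m - real k - 1)))"
    by (simp add: harmonic_coeff_def)
  then have L: "?L = ?H - ?Z"
    unfolding sum_subtractf[symmetric]
    by (simp add: harmonic_correction_limit_altdef diff_divide_distrib flip: sum_subtractf)
  have closed: "(\<Sum>n=1..N. (harm n :: real) ^ M) =
      (real N + 1) * harm (N + 1) ^ M + (-1) ^ M * fact M *
       ((\<Sum>m=3..M-1. (-1) ^ m / fact m * harm (N + 1) ^ m * (real N + 3 / 2))
        + real N + 1 + (real N / 2 + 3 / 4) * harm (N + 1) ^ 2 - (real N + 3 / 2) * harm (N + 1)
        + (\<Sum>m=3..M. harmonic_correction m (N + 1) / fact m))" for N
  proof -
    have shifts: "real (N + 1) = real N + 1" 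
      "(real N + 1) / 2 + 1 / 4 = real N / 2 + 3 / 4"
      "real N + 1 + 1 / 2 = real N + 3 / 2" by (simp_all add: field_simps)
    show ?thesis
      using sum_harm_power_shift[of M N] sum_harm_power_closed_form[OF M, of "N + 1"] M
      unfolding shifts by (simp only: add.assoc)
  qed
  have "(\<lambda>N. \<Sum>m=3..M. harmonic_correction m (N + 1) / fact m) \<longlonglongrightarrow> ?L"
    by (intro tendsto_intros LIMSEQ_ignore_initial_segment harmonic_correction_LIMSEQ) auto
  then have "(\<lambda>N. (-1) ^ M * fact M *
      ((\<Sum>m=3..M. harmonic_correction m (N + 1) / fact m) - ?L)) \<longlonglongrightarrow> (-1) ^ M * fact M * (?L - ?L)"
    by (intro tendsto_mult tendsto_diff tendsto_const)
  then have lim: "(\<lambda>N. (-1) ^ M * fact M *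
      ((\<Sum>m=3..M. harmonic_correction m (N + 1) / fact m) - ?L)) \<longlonglongrightarrow> 0" by simp
  \<comment> \<open>All terms that grow with \<open>N\<close> sit in \<open>a\<close> and
    \<open>b\<close> and cancel exactly. What is left is the constant \<open>c\<close> times the
    difference between the finite sum of corrections and its limit.\<close>
  have alg: "(a + c * (b + x)) - (a + c * (b - z + h)) = c * (x - l)" if "l = h - z"
    for a b c x z h l :: real
    unfolding that by (simp add: algebra_simps)
  show "(\<lambda>N::nat. (\<Sum>n=1..N. (harm n :: real) ^ M) -
               ((real N + 1) * harm (N + 1) ^ M +
                (-1) ^ M * fact M *
                  ((\<Sum>m=3..M-1. (-1) ^ m / fact m * harm (N + 1) ^ m * (real N + 3 / 2))
                   + real N + 1
                   + (real N / 2 + 3 / 4) * harm (N + 1) ^ 2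
                   - (real N + 3 / 2) * harm (N + 1)
                   - ?Z + ?H)))
            \<longlonglongrightarrow> 0"
    unfolding closed alg[OF L] by (rule lim)
qed

end
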